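(* Let $k,m$ be positive integers. (i) The spectrum of $\mathcal{I}(K^M_{k(m)})$ consists of $2m(k-1)$ with multiplicity $1$, $-2m$ with multiplicity $k-1$, and $0$ with multiplicity $(2m-1)k$. (ii) The spectrum of $\mathcal{I}(K^D_{k(m)})$ consists of $m(k-1)$ and $-m(k-1)$, each with multiplicity $1$, $m$ and $-m$, each with multiplicity $k-1$, and $0$ with multiplicity $2k(m-1)$. (The spectrum is the multiset union of the listed values; multiplicities add if listed values coincide.)
   Context: A mixed graph $G$ has a finite nonempty vertex set $V_G=\{v_1,\dots,v_n\}$, a finite set $E_G$ of (undirected) edges, each joining an unordered pair of vertices, and a finite set $\vec E_G$ of arcs, each going from $u$ to $v$ for an ordered pair $(u,v)$ of vertices. The integrated adjacency matrix $\mathcal{I}(G)$ is the real symmetric $2n\times 2n$ matrix $\begin{bmatrix}A&D\\ D^T&A\end{bmatrix}$, where $A_{ij}$ ($i\neq j$) is the number of edges joining $v_i$ and $v_j$, $A_{ii}$ is twice the number of loops at $v_i$, and $D_{ij}$ is the number of arcs from $v_i$ to $v_j$. $K^M_{k(m)}$ (the complete $k$-partite mixed graph with all parts of size $m$) has vertex set partitioned into $k$ sets $V_1,\dots,V_k$ of size $m$; for any $u\in V_i$, $v\in V_j$ with $i\ne j$ there are exactly one edge joining $u$ and $v$, exactly one arc from $u$ to $v$ and exactly one arc from $v$ to $u$; there are no other edges or arcs. $K^D_{k(m)}$ (the complete $k$-partite directed graph) is defined in the same way but with only the two arcs (one in each direction) and no edges. *)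

theory Defs
  imports
    "HOL-Library.Uprod"
    "HOL-Library.Disjoint_Sets"
    "Jordan_Normal_Form.Char_Poly"
begin

text \<open>
  Edges and arcs are abstract objects with incidence functions, so that parallel edges, parallel
  arcs and loops are all possible; a loop at \<open>u\<close> is an edge with ends \<open>Upair u u\<close>.
\<close>

record ('v, 'e, 'a) pre_mixed_graph =
  verts :: "'v set"
  edges :: "'e set"
  ends :: "'e \<Rightarrow> 'v uprod"
  arcs :: "'a set"
  tail :: "'a \<Rightarrow> 'v"
  head :: "'a \<Rightarrow> 'v"

locale mixed_graph =
  fixes G :: "('v, 'e, 'a) pre_mixed_graph"
  assumes finite_verts: "finite (verts G)"
    and verts_nonempty: "verts G \<noteq> {}"
    and finite_edges: "finite (edges G)"
    and ends_in_verts: "e \<in> edges G \<Longrightarrow> set_uprod (ends G e) \<subseteq> verts G"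
    and finite_arcs: "finite (arcs G)"
    and tail_in_verts: "a \<in> arcs G \<Longrightarrow> tail G a \<in> verts G"
    and head_in_verts: "a \<in> arcs G \<Longrightarrow> head G a \<in> verts G"

definition num_edges :: "('v, 'e, 'a) pre_mixed_graph \<Rightarrow> 'v \<Rightarrow> 'v \<Rightarrow> nat" where
  "num_edges G u v = card {e \<in> edges G. ends G e = Upair u v}"

definition num_arcs :: "('v, 'e, 'a) pre_mixed_graph \<Rightarrow> 'v \<Rightarrow> 'v \<Rightarrow> nat" where
  "num_arcs G u v = card {a \<in> arcs G. tail G a = u \<and> head G a = v}"

text \<open>The list \<open>vs\<close> below plays the role of the enumeration \<open>v\<^sub>1, \<dots>, v\<^sub>n\<close> of the vertices.\<close>

definition enumerates :: "'v list \<Rightarrow> 'v set \<Rightarrow> bool" where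
  "enumerates vs V \<longleftrightarrow> distinct vs \<and> set vs = V"

definition edge_mat :: "('v, 'e, 'a) pre_mixed_graph \<Rightarrow> 'v list \<Rightarrow> real mat" where
  "edge_mat G vs = mat (length vs) (length vs)
     (\<lambda>(i, j). if i = j then 2 * real (num_edges G (vs ! i) (vs ! i))
               else real (num_edges G (vs ! i) (vs ! j)))"

definition arc_mat :: "('v, 'e, 'a) pre_mixed_graph \<Rightarrow> 'v list \<Rightarrow> real mat" where
  "arc_mat G vs = mat (length vs) (length vs) (\<lambda>(i, j). real (num_arcs G (vs ! i) (vs ! j)))"

definition integrated_adjacency_mat ::
    "('v, 'e, 'a) pre_mixed_graph \<Rightarrow> 'v list \<Rightarrow> real mat" where
  "integrated_adjacency_mat G vs =
     four_block_mat (edge_mat G vs) (arc_mat G vs) (transpose_mat (arc_mat G vs)) (edge_mat G vs)"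

text \<open>
  The eigenvalues with their algebraic multiplicities. Only real eigenvalues are counted, which
  is all of them for a symmetric matrix; there algebraic and geometric multiplicity agree.
\<close>

definition spectrum_mset :: "real mat \<Rightarrow> real multiset" where
  "spectrum_mset A = proots (char_poly A)"

definition equipartition :: "nat \<Rightarrow> nat \<Rightarrow> (nat \<Rightarrow> 'v set) \<Rightarrow> 'v set \<Rightarrow> bool" where
  "equipartition k m P V \<longleftrightarrow>
     disjoint_family_on P {..<k} \<and> (\<Union>i<k. P i) = V \<and> (\<forall>i<k. card (P i) = m)"

text \<open>
  In the next two definitions the clause for \<open>i = j\<close> (including \<open>u = v\<close>) says that there are no
  edges or arcs other than the prescribed ones.
\<close>

definition complete_multipartite_mixed ::
    "nat \<Rightarrow> nat \<Rightarrow> ('v, 'e, 'a) pre_mixed_graph \<Rightarrow> bool" where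
  "complete_multipartite_mixed k m G \<longleftrightarrow> mixed_graph G \<and>
     (\<exists>P. equipartition k m P (verts G) \<and>
       (\<forall>i<k. \<forall>j<k. \<forall>u\<in>P i. \<forall>v\<in>P j.
          num_edges G u v = (if i = j then 0 else 1) \<and>
          num_arcs G u v = (if i = j then 0 else 1)))"

definition complete_multipartite_directed ::
    "nat \<Rightarrow> nat \<Rightarrow> ('v, 'e, 'a) pre_mixed_graph \<Rightarrow> bool" where
  "complete_multipartite_directed k m G \<longleftrightarrow> mixed_graph G \<and> edges G = {} \<and>
     (\<exists>P. equipartition k m P (verts G) \<and>
       (\<forall>i<k. \<forall>j<k. \<forall>u\<in>P i. \<forall>v\<in>P j.
          num_arcs G u v = (if i = j then 0 else 1)))"

end

theory Submission
  imports Defs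
begin

text \<open>
  List the vertices in any order and let \<open>B c\<close> be the matrix with entry \<open>c\<close> where the two
  vertices lie in different parts and \<open>0\<close> elsewhere. The integrated adjacency matrix has
  diagonal blocks \<open>B 1\<close> for \<open>K\<^sup>M\<close> and \<open>B 0\<close> for \<open>K\<^sup>D\<close>, and off-diagonal blocks \<open>B 1\<close> in both
  cases. Passing to the sum and the difference of the two halves of a vector diagonalises a
  matrix with blocks \<open>A, D, D, A\<close> into \<open>A + D\<close> and \<open>A - D\<close>
  (\<open>char_poly_four_block_symmetric\<close>), so the spectrum is that of \<open>B 2\<close> together with \<open>B 0\<close> for
  \<open>K\<^sup>M\<close>, and that of \<open>B 1\<close> together with \<open>B (- 1)\<close> for \<open>K\<^sup>D\<close>.

  It remains to find the spectrum of \<open>B c\<close> (\<open>spectrum_multipartite_mat\<close>). This matrix factors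
  through the \<open>k\<close>-dimensional space of functions on the parts. Since \<open>M * N\<close> and \<open>N * M\<close> have the
  same nonzero eigenvalues (\<open>det_scalar_minus_mult_swap\<close>), it may be replaced by the \<open>k \<times> k\<close>
  matrix \<open>c m (J - I)\<close>, where \<open>J\<close> is the all-ones matrix. The latter is handled by the same
  principle, as \<open>J\<close> is a column times a row.
\<close>

section \<open>Two determinant identities\<close>

text \<open>
  Both determinants are those of Schur complements in the block matrix \<open>[x I, M; N, I]\<close>.
  Eliminating with the block \<open>I\<close> gives \<open>x I - M * N\<close> directly. Eliminating with \<open>x I\<close> would
  divide by \<open>x\<close>; multiplying the second block row by \<open>x\<close> instead costs the factor \<open>x ^ k\<close>, and
  \<open>x ^ n\<close> is the determinant of the block \<open>x I\<close> itself.
\<close>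

lemma det_scalar_minus_mult_swap:
  fixes x :: "'a :: idom"
  assumes M: "M \<in> carrier_mat n k" and N: "N \<in> carrier_mat k n"
  shows "x ^ k * det (x \<cdot>\<^sub>m 1\<^sub>m n - M * N) = x ^ n * det (x \<cdot>\<^sub>m 1\<^sub>m k - N * M)"
proof -
  let ?F = "four_block_mat (x \<cdot>\<^sub>m 1\<^sub>m n) M N (1\<^sub>m k)"
  have F: "?F \<in> carrier_mat (n + k) (n + k)" by auto
  let ?R = "four_block_mat (1\<^sub>m n) (0\<^sub>m n k) (- N) (1\<^sub>m k)"
  have R: "?R \<in> carrier_mat (n + k) (n + k)" by auto
  have "?F * ?R = four_block_mat (x \<cdot>\<^sub>m 1\<^sub>m n * 1\<^sub>m n + M * (- N)) (x \<cdot>\<^sub>m 1\<^sub>m n * 0\<^sub>m n k + M * 1\<^sub>m k)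
      (N * 1\<^sub>m n + 1\<^sub>m k * (- N)) (N * 0\<^sub>m n k + 1\<^sub>m k * 1\<^sub>m k)"
    using M N by (intro mult_four_block_mat) auto
  also have "\<dots> = four_block_mat (x \<cdot>\<^sub>m 1\<^sub>m n - M * N) M (0\<^sub>m k n) (1\<^sub>m k)"
    using M N by (intro cong_four_block_mat) auto
  also have "det \<dots> = det (x \<cdot>\<^sub>m 1\<^sub>m n - M * N)"
    using M N by (subst det_four_block_mat_lower_left_zero[where n = n and m = k])
      (auto intro!: minus_carrier_mat)
  finally have FR: "det (?F * ?R) = det (x \<cdot>\<^sub>m 1\<^sub>m n - M * N)" .
  have "det ?R = 1"
    using N by (subst det_four_block_mat_upper_right_zero[where n = n and m = k]) auto
  with FR have 1: "det ?F = det (x \<cdot>\<^sub>m 1\<^sub>m n - M * N)"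
    using det_mult[OF F R] by simp
  let ?L = "four_block_mat (1\<^sub>m n) (0\<^sub>m n k) (- N) (x \<cdot>\<^sub>m 1\<^sub>m k)"
  have L: "?L \<in> carrier_mat (n + k) (n + k)" by auto
  have "?L * ?F = four_block_mat (1\<^sub>m n * (x \<cdot>\<^sub>m 1\<^sub>m n) + 0\<^sub>m n k * N) (1\<^sub>m n * M + 0\<^sub>m n k * 1\<^sub>m k)
      (- N * (x \<cdot>\<^sub>m 1\<^sub>m n) + (x \<cdot>\<^sub>m 1\<^sub>m k) * N) (- N * M + (x \<cdot>\<^sub>m 1\<^sub>m k) * 1\<^sub>m k)"
    using M N by (intro mult_four_block_mat) auto
  also have "\<dots> = four_block_mat (x \<cdot>\<^sub>m 1\<^sub>m n) M (0\<^sub>m k n) (x \<cdot>\<^sub>m 1\<^sub>m k - N * M)"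
    using M N by (intro cong_four_block_mat eq_matI) auto
  also have "det \<dots> = x ^ n * det (x \<cdot>\<^sub>m 1\<^sub>m k - N * M)"
    using M N by (subst det_four_block_mat_lower_left_zero[where n = n and m = k])
      (auto intro!: minus_carrier_mat)
  finally have "det (?L * ?F) = x ^ n * det (x \<cdot>\<^sub>m 1\<^sub>m k - N * M)" .
  moreover have "det ?L = x ^ k"
    using N by (subst det_four_block_mat_upper_right_zero[where n = n and m = k]) auto
  ultimately show ?thesis
    using det_mult[OF L F] 1 by simp
qed

text \<open>
  Adding the second block row to the first, and then subtracting the first block column from the
  second, makes the matrix block triangular. A change of basis to the sum and the difference of
  the two halves would even make it block diagonal, but only where \<open>2\<close> is invertible.
\<close>

lemma det_four_block_symmetric:
  fixes A D :: "'a :: idom mat"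
  assumes A: "A \<in> carrier_mat n n" and D: "D \<in> carrier_mat n n"
  shows "det (four_block_mat A D D A) = det (A + D) * det (A - D)"
proof -
  let ?F = "four_block_mat A D D A"
  let ?L = "four_block_mat (1\<^sub>m n) (1\<^sub>m n) (0\<^sub>m n n) (1\<^sub>m n) :: 'a mat"
  let ?R = "four_block_mat (1\<^sub>m n) (- 1\<^sub>m n) (0\<^sub>m n n) (1\<^sub>m n) :: 'a mat"
  have F: "?F \<in> carrier_mat (n + n) (n + n)" and L: "?L \<in> carrier_mat (n + n) (n + n)"
    and R: "?R \<in> carrier_mat (n + n) (n + n)" using A by auto
  have "?L * ?F = four_block_mat (1\<^sub>m n * A + 1\<^sub>m n * D) (1\<^sub>m n * D + 1\<^sub>m n * A)
      (0\<^sub>m n n * A + 1\<^sub>m n * D) (0\<^sub>m n n * D + 1\<^sub>m n * A)"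
    using A D by (intro mult_four_block_mat) auto
  also have "\<dots> = four_block_mat (A + D) (A + D) D A"
    using A D by (intro cong_four_block_mat eq_matI) auto
  finally have "?L * ?F * ?R = four_block_mat (A + D) (A + D) D A * ?R" by simp
  also have "\<dots> = four_block_mat
      ((A + D) * 1\<^sub>m n + (A + D) * 0\<^sub>m n n) ((A + D) * (- 1\<^sub>m n) + (A + D) * 1\<^sub>m n)
      (D * 1\<^sub>m n + A * 0\<^sub>m n n) (D * (- 1\<^sub>m n) + A * 1\<^sub>m n)"
    using A D by (intro mult_four_block_mat) auto
  also have "\<dots> = four_block_mat (A + D) (0\<^sub>m n n) D (A - D)"
    using A D by (intro cong_four_block_mat eq_matI) auto
  also have "det \<dots> = det (A + D) * det (A - D)"
    using A D by (subst det_four_block_mat_upper_right_zero[where n = n and m = n])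
      (auto intro!: minus_carrier_mat)
  finally have "det (?L * ?F * ?R) = det (A + D) * det (A - D)" .
  moreover have "det ?L = 1" "det ?R = 1"
    by (auto simp: det_four_block_mat_lower_left_zero[where n = n and m = n])
  ultimately show ?thesis
    using det_mult[OF mult_carrier_mat[OF L F] R] det_mult[OF L F] by simp
qed

lemma char_poly_four_block_symmetric:
  fixes A D :: "'a :: idom mat"
  assumes A: "A \<in> carrier_mat n n" and D: "D \<in> carrier_mat n n"
  shows "char_poly (four_block_mat A D D A) = char_poly (A + D) * char_poly (A - D)"
proof -
  let ?D = "map_mat (\<lambda>a. [:- a:]) D"
  have "char_poly_matrix (four_block_mat A D D A)
      = four_block_mat (char_poly_matrix A) ?D ?D (char_poly_matrix A)"
    using A D by (intro eq_matI) (auto simp: char_poly_matrix_def)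
  moreover have "char_poly_matrix A + ?D = char_poly_matrix (A + D)"
    "char_poly_matrix A - ?D = char_poly_matrix (A - D)"
    using A D by (auto simp: char_poly_matrix_def intro!: eq_matI)
  ultimately show ?thesis
    using A D by (simp add: char_poly_def det_four_block_symmetric[where n = n])
qed

section \<open>Spectrum of a complete multipartite pattern\<close>

text \<open>\<open>f\<close> assigns to each index its part.\<close>

definition multipartite_mat :: "(nat \<Rightarrow> nat) \<Rightarrow> real \<Rightarrow> nat \<Rightarrow> real mat" where
  "multipartite_mat f c n = mat n n (\<lambda>(i, j). if f i = f j then 0 else c)"

lemma multipartite_mat_carrier [simp]: "multipartite_mat f c n \<in> carrier_mat n n"
  by (simp add: multipartite_mat_def)

lemma multipartite_mat_add:
  "multipartite_mat f c n + multipartite_mat f d n = multipartite_mat f (c + d) n"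
  by (auto simp: multipartite_mat_def intro!: eq_matI)

lemma multipartite_mat_diff:
  "multipartite_mat f c n - multipartite_mat f d n = multipartite_mat f (c - d) n"
  by (auto simp: multipartite_mat_def intro!: eq_matI)

text \<open>The all-ones matrix is a column times a row, so the determinant reduces to a \<open>1 \<times> 1\<close> one.\<close>

lemma det_scalar_minus_const:
  fixes y a :: "'a :: idom"
  shows "y * det (y \<cdot>\<^sub>m 1\<^sub>m k - mat k k (\<lambda>_. a)) = y ^ k * (y - of_nat k * a)"
proof -
  let ?M = "mat k 1 (\<lambda>_. 1 :: 'a)" and ?N = "mat 1 k (\<lambda>_. a)"
  have "?M * ?N = mat k k (\<lambda>_. a)"
    by (intro eq_matI) (auto simp: scalar_prod_def)
  moreover have "det (y \<cdot>\<^sub>m 1\<^sub>m 1 - ?N * ?M) = y - of_nat k * a"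
    by (subst det_single) (auto simp: scalar_prod_def)
  ultimately show ?thesis
    using det_scalar_minus_mult_swap[of ?M k 1 ?N y] by simp
qed

text \<open>
  Applying \<open>det_scalar_minus_mult_swap\<close> to the factorisation through functions on the parts turns
  the characteristic matrix into \<open>(X + c m) I - c m J\<close>, which \<open>det_scalar_minus_const\<close> evaluates.
  The two extra factors on the left are the ones these two identities leave there.
\<close>

lemma char_poly_multipartite_mat:
  fixes f :: "nat \<Rightarrow> nat"
  assumes f: "\<And>i. i < n \<Longrightarrow> f i < k"
    and parts: "\<And>p. p < k \<Longrightarrow> card {i. i < n \<and> f i = p} = m"
  shows "[:c * real m, 1:] * [:0, 1:] ^ k * char_poly (multipartite_mat f c n)
    = [:0, 1:] ^ n * [:c * real m, 1:] ^ k * [:- (c * real m * (real k - 1)), 1:]"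
proof -
  let ?X = "[:0, 1:] :: real poly"
  \<comment> \<open>\<open>M\<close> extends a function on the parts to the indices; \<open>N\<close> sums, with weight \<open>c\<close>, over the
    indices outside a part.\<close>
  let ?M = "mat n k (\<lambda>(i, p). if f i = p then 1 else 0) :: real poly mat"
  let ?N = "mat k n (\<lambda>(p, j). if p = f j then 0 else [:c:])"
  let ?y = "[:c * real m, 1:]"
  have MN: "char_poly_matrix (multipartite_mat f c n) = ?X \<cdot>\<^sub>m 1\<^sub>m n - ?M * ?N"
  proof (intro eq_matI, goal_cases)
    case (1 i j)
    then have ij: "i < n" "j < n" by auto
    have "(?M * ?N) $$ (i, j)
        = (\<Sum>p\<in>{0..<k}. (if f i = p then 1 else 0) * (if p = f j then 0 else [:c:]))"
      using ij by (simp add: scalar_prod_def)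
    also have "\<dots> = (\<Sum>p\<in>{0..<k}. if f i = p then (if f i = f j then 0 else [:c:]) else 0)"
      by (intro sum.cong) auto
    also have "\<dots> = (if f i = f j then 0 else [:c:])"
      using f[OF ij(1)] by simp
    finally have "(?M * ?N) $$ (i, j) = (if f i = f j then 0 else [:c:])" .
    then show ?case using ij
      by (simp add: char_poly_matrix_def multipartite_mat_def del: index_mult_mat(1))
  qed (auto simp: char_poly_matrix_def multipartite_mat_def)
  have NM: "?N * ?M = mat k k (\<lambda>(p, q). if p = q then 0 else [:c * real m:])"
  proof (intro eq_matI, goal_cases)
    case (1 p q)
    then have pq: "p < k" "q < k" by auto
    have "(?N * ?M) $$ (p, q)
        = (\<Sum>j\<in>{0..<n}. (if p = f j then 0 else [:c:]) * (if f j = q then 1 else 0))"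
      using pq by (simp add: scalar_prod_def)
    also have "\<dots> = (\<Sum>j\<in>{0..<n}. if f j = q then (if p = q then 0 else [:c:]) else 0)"
      by (intro sum.cong) auto
    also have "\<dots> = (\<Sum>j\<in>{j. j < n \<and> f j = q}. if p = q then 0 else [:c:])"
      by (subst sum.inter_filter[symmetric]) (auto intro: sum.cong)
    also have "\<dots> = of_nat m * (if p = q then 0 else [:c:])"
      using parts[OF pq(2)] by simp
    finally show ?case using pq by (simp add: of_nat_poly mult.commute)
  qed auto
  have shift: "?X \<cdot>\<^sub>m 1\<^sub>m k - ?N * ?M = ?y \<cdot>\<^sub>m 1\<^sub>m k - mat k k (\<lambda>_. [:c * real m:])"
    unfolding NM by (intro eq_matI) auto
  have "?X ^ k * char_poly (multipartite_mat f c n) = ?X ^ n * det (?X \<cdot>\<^sub>m 1\<^sub>m k - ?N * ?M)"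
    unfolding char_poly_def MN by (rule det_scalar_minus_mult_swap) auto
  then have "?y * ?X ^ k * char_poly (multipartite_mat f c n)
      = ?X ^ n * (?y * det (?y \<cdot>\<^sub>m 1\<^sub>m k - mat k k (\<lambda>_. [:c * real m:])))"
    unfolding shift by (simp only: mult.left_commute mult.assoc)
  also have "\<dots> = ?X ^ n * ?y ^ k * (?y - of_nat k * [:c * real m:])"
    unfolding det_scalar_minus_const by (simp only: mult.assoc)
  also have "?y - of_nat k * [:c * real m:] = [:- (c * real m * (real k - 1)), 1:]"
    by (simp add: of_nat_poly algebra_simps)
  finally show ?thesis .
qed

text \<open>
  Cancelling the common factors of \<open>char_poly_multipartite_mat\<close> leaves a product of linear
  factors. The case \<open>c = 0\<close>, where all listed values are zero, is used for the difference of two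
  equal blocks.
\<close>

lemma spectrum_multipartite_mat:
  fixes f :: "nat \<Rightarrow> nat"
  assumes "k > 0" "m > 0"
    and f: "\<And>i. i < k * m \<Longrightarrow> f i < k"
    and parts: "\<And>p. p < k \<Longrightarrow> card {i. i < k * m \<and> f i = p} = m"
  shows "spectrum_mset (multipartite_mat f c (k * m)) =
    {#c * real m * (real k - 1)#} + replicate_mset (k - 1) (- (c * real m))
    + replicate_mset (k * (m - 1)) 0"
proof -
  let ?X = "[:0, 1:] :: real poly" and ?y = "[:c * real m, 1:]"
  let ?z = "[:- (c * real m * (real k - 1)), 1:]"
  have n: "k * m = k + k * (m - 1)"
    using assms(2) by (cases m) auto
  have k: "?y ^ k = ?y * ?y ^ (k - 1)"
    using assms(1) by (cases k) auto
  have "?y * ?X ^ k * char_poly (multipartite_mat f c (k * m)) = ?X ^ (k * m) * ?y ^ k * ?z"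
    by (rule char_poly_multipartite_mat[OF f parts])
  also have "?X ^ (k * m) = ?X ^ k * ?X ^ (k * (m - 1))"
    by (subst n) (rule power_add)
  finally have "(?y * ?X ^ k) * char_poly (multipartite_mat f c (k * m))
      = (?y * ?X ^ k) * (?z * ?y ^ (k - 1) * ?X ^ (k * (m - 1)))"
    unfolding k by (simp only: ac_simps)
  moreover have "?y * ?X ^ k \<noteq> 0" by (simp del: mult_pCons_left)
  ultimately have "char_poly (multipartite_mat f c (k * m))
      = ?z * ?y ^ (k - 1) * ?X ^ (k * (m - 1))"
    by (simp only: mult_cancel_left simp_thms)
  then show ?thesis
    by (simp add: spectrum_mset_def proots_mult proots_power del: mult_pCons_left mult_pCons_right)
qed

lemma spectrum_four_block_symmetric:
  assumes "A \<in> carrier_mat n n" "D \<in> carrier_mat n n"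
  shows "spectrum_mset (four_block_mat A D D A) = spectrum_mset (A + D) + spectrum_mset (A - D)"
proof -
  have "char_poly B \<noteq> 0" if "B \<in> carrier_mat n n" for B :: "real mat"
    using degree_monic_char_poly[OF that] by auto
  then have "char_poly (A + D) \<noteq> 0" "char_poly (A - D) \<noteq> 0"
    using assms by (auto intro!: minus_carrier_mat add_carrier_mat)
  then show ?thesis
    using assms by (simp add: spectrum_mset_def char_poly_four_block_symmetric proots_mult)
qed

section \<open>The two families of graphs\<close>

lemma equipartition_index_map:
  assumes P: "equipartition k m P V" and vs: "enumerates vs V" and "m > 0"
  obtains f where "length vs = k * m"
    and "\<And>i. i < k * m \<Longrightarrow> f i < k" and "\<And>i. i < k * m \<Longrightarrow> vs ! i \<in> P (f i)"
    and "\<And>p. p < k \<Longrightarrow> card {i. i < k * m \<and> f i = p} = m"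
proof -
  have disj: "disjoint_family_on P {..<k}" and V: "(\<Union>i<k. P i) = V"
    and card: "\<And>p. p < k \<Longrightarrow> card (P p) = m"
    using P by (auto simp: equipartition_def)
  have dist: "distinct vs" and set: "set vs = V"
    using vs by (auto simp: enumerates_def)
  have fin: "finite (P p)" if "p < k" for p
    using card[OF that] \<open>m > 0\<close> by (metis card.infinite less_irrefl)
  have "length vs = card (\<Union>i<k. P i)"
    using dist set V by (simp add: distinct_card[symmetric])
  also have "\<dots> = (\<Sum>i<k. card (P i))"
    using fin disj by (intro card_UN_disjoint) (auto simp: disjoint_family_on_def)
  finally have len: "length vs = k * m"
    using card by simp
  have "\<exists>p. p < k \<and> vs ! i \<in> P p" if "i < k * m" for i
  proof -
    have "vs ! i \<in> V" using that set len by auto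
    then show ?thesis using V by auto
  qed
  then obtain f where f: "\<And>i. i < k * m \<Longrightarrow> f i < k \<and> vs ! i \<in> P (f i)"
    by metis
  have uniq: "f i = p" if "i < k * m" "p < k" "vs ! i \<in> P p" for i p
    using disj f[OF that(1)] that by (auto simp: disjoint_family_on_def)
  have "card {i. i < k * m \<and> f i = p} = m" if p: "p < k" for p
  proof -
    have "bij_betw ((!) vs) {i. i < k * m \<and> f i = p} (P p)"
      unfolding bij_betw_def
    proof
      show "inj_on ((!) vs) {i. i < k * m \<and> f i = p}"
        using dist len by (auto simp: inj_on_def nth_eq_iff_index_eq)
      show "(!) vs ` {i. i < k * m \<and> f i = p} = P p"
      proof
        show "(!) vs ` {i. i < k * m \<and> f i = p} \<subseteq> P p" using f by auto
        show "P p \<subseteq> (!) vs ` {i. i < k * m \<and> f i = p}"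
        proof
          fix v assume v: "v \<in> P p"
          with p V set have "v \<in> set vs" by auto
          then obtain i where "i < length vs" "vs ! i = v" by (auto simp: in_set_conv_nth)
          with uniq[of i p] v p len
          show "v \<in> (!) vs ` {i. i < k * m \<and> f i = p}" by auto
        qed
      qed
    qed
    then show ?thesis using card[OF p] by (metis bij_betw_same_card)
  qed
  with that len f show ?thesis by blast
qed

lemma spectrum_complete_multipartite_mixed:
  assumes "k > 0" "m > 0" and vs: "enumerates vs (verts G)"
    and G: "complete_multipartite_mixed k m G"
  shows "spectrum_mset (integrated_adjacency_mat G vs) =
    {#2 * real m * (real k - 1)#} + replicate_mset (k - 1) (- (2 * real m))
    + replicate_mset ((2 * m - 1) * k) 0"
proof -
  obtain P where P: "equipartition k m P (verts G)"
    and num: "\<And>i j u v. i < k \<Longrightarrow> j < k \<Longrightarrow> u \<in> P i \<Longrightarrow> v \<in> P j \<Longrightarrow>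
      num_edges G u v = (if i = j then 0 else 1) \<and> num_arcs G u v = (if i = j then 0 else 1)"
    using G unfolding complete_multipartite_mixed_def by blast
  obtain f where len: "length vs = k * m"
    and f: "\<And>i. i < k * m \<Longrightarrow> f i < k" "\<And>i. i < k * m \<Longrightarrow> vs ! i \<in> P (f i)"
    and parts: "\<And>p. p < k \<Longrightarrow> card {i. i < k * m \<and> f i = p} = m"
    using equipartition_index_map[OF P vs \<open>m > 0\<close>] by metis
  have entry: "num_edges G (vs ! i) (vs ! j) = (if f i = f j then 0 else 1)"
    "num_arcs G (vs ! i) (vs ! j) = (if f i = f j then 0 else 1)"
    if "i < k * m" "j < k * m" for i j
    using num[OF f(1)[OF that(1)] f(1)[OF that(2)] f(2)[OF that(1)] f(2)[OF that(2)]] by auto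
  let ?B = "\<lambda>c. multipartite_mat f c (k * m)"
  have blocks: "edge_mat G vs = ?B 1" "arc_mat G vs = ?B 1" "transpose_mat (?B 1) = ?B 1"
    by (auto simp: edge_mat_def arc_mat_def multipartite_mat_def len entry intro!: eq_matI)
  have "spectrum_mset (integrated_adjacency_mat G vs)
      = spectrum_mset (?B 2) + spectrum_mset (?B 0)"
    unfolding integrated_adjacency_mat_def blocks
    by (simp add: spectrum_four_block_symmetric[where n = "k * m"]
        multipartite_mat_add multipartite_mat_diff)
  also have "\<dots> = {#2 * real m * (real k - 1)#} + replicate_mset (k - 1) (- (2 * real m))
      + (replicate_mset (k * (m - 1)) 0 + replicate_mset 1 0 + replicate_mset (k - 1) 0
         + replicate_mset (k * (m - 1)) 0)"
    by (simp add: spectrum_multipartite_mat[OF assms(1,2) f(1) parts])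
  also have "replicate_mset (k * (m - 1)) (0 :: real) + replicate_mset 1 0
        + replicate_mset (k - 1) 0 + replicate_mset (k * (m - 1)) 0
      = replicate_mset (k * (m - 1) + 1 + (k - 1) + k * (m - 1)) 0"
    by (intro multiset_eqI) simp
  also have "k * (m - 1) + 1 + (k - 1) + k * (m - 1) = (2 * m - 1) * k"
    using assms(1,2) by (cases m) (auto simp: algebra_simps)
  finally show ?thesis .
qed

lemma spectrum_complete_multipartite_directed:
  assumes "k > 0" "m > 0" and vs: "enumerates vs (verts G)"
    and G: "complete_multipartite_directed k m G"
  shows "spectrum_mset (integrated_adjacency_mat G vs) =
    {#real m * (real k - 1)#} + {#- (real m * (real k - 1))#}
    + replicate_mset (k - 1) (real m) + replicate_mset (k - 1) (- real m)
    + replicate_mset (2 * k * (m - 1)) 0"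
proof -
  obtain P where P: "equipartition k m P (verts G)" and no_edges: "edges G = {}"
    and num: "\<And>i j u v. i < k \<Longrightarrow> j < k \<Longrightarrow> u \<in> P i \<Longrightarrow> v \<in> P j \<Longrightarrow>
      num_arcs G u v = (if i = j then 0 else 1)"
    using G unfolding complete_multipartite_directed_def by blast
  obtain f where len: "length vs = k * m"
    and f: "\<And>i. i < k * m \<Longrightarrow> f i < k" "\<And>i. i < k * m \<Longrightarrow> vs ! i \<in> P (f i)"
    and parts: "\<And>p. p < k \<Longrightarrow> card {i. i < k * m \<and> f i = p} = m"
    using equipartition_index_map[OF P vs \<open>m > 0\<close>] by metis
  have entry: "num_arcs G (vs ! i) (vs ! j) = (if f i = f j then 0 else 1)"
    if "i < k * m" "j < k * m" for i j
    using num[OF f(1)[OF that(1)] f(1)[OF that(2)] f(2)[OF that(1)] f(2)[OF that(2)]] .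
  let ?B = "\<lambda>c. multipartite_mat f c (k * m)"
  have blocks: "edge_mat G vs = ?B 0" "arc_mat G vs = ?B 1" "transpose_mat (?B 1) = ?B 1"
    by (auto simp: edge_mat_def arc_mat_def multipartite_mat_def len entry num_edges_def no_edges
        intro!: eq_matI)
  have "spectrum_mset (integrated_adjacency_mat G vs)
      = spectrum_mset (?B 1) + spectrum_mset (?B (- 1))"
    unfolding integrated_adjacency_mat_def blocks
    by (simp add: spectrum_four_block_symmetric[where n = "k * m"]
        multipartite_mat_add multipartite_mat_diff)
  also have "\<dots> = {#real m * (real k - 1)#} + {#- (real m * (real k - 1))#}
      + replicate_mset (k - 1) (real m) + replicate_mset (k - 1) (- real m)
      + (replicate_mset (k * (m - 1)) 0 + replicate_mset (k * (m - 1)) 0)"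
    by (simp add: spectrum_multipartite_mat[OF assms(1,2) f(1) parts])
  also have "replicate_mset (k * (m - 1)) (0 :: real) + replicate_mset (k * (m - 1)) 0
      = replicate_mset (k * (m - 1) + k * (m - 1)) 0"
    by (intro multiset_eqI) simp
  also have "k * (m - 1) + k * (m - 1) = 2 * k * (m - 1)" by simp
  finally show ?thesis .
qed

theorem theorem5p3:
  fixes k m :: nat
    and G :: "('v, 'e, 'a) pre_mixed_graph"
    and vs :: "'v list"
  assumes "k > 0" and "m > 0"
    and "enumerates vs (verts G)"
  shows "(complete_multipartite_mixed k m G \<longrightarrow>
            spectrum_mset (integrated_adjacency_mat G vs) =
              {#2 * real m * (real k - 1)#}
              + replicate_mset (k - 1) (- (2 * real m))
              + replicate_mset ((2 * m - 1) * k) 0)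
       \<and> (complete_multipartite_directed k m G \<longrightarrow>
            spectrum_mset (integrated_adjacency_mat G vs) =
              {#real m * (real k - 1)#}
              + {#- (real m * (real k - 1))#}
              + replicate_mset (k - 1) (real m)
              + replicate_mset (k - 1) (- real m)
              + replicate_mset (2 * k * (m - 1)) 0)"
  using spectrum_complete_multipartite_mixed[OF assms]
    spectrum_complete_multipartite_directed[OF assms] by blast

end
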